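(* For $m,n\ge1$ let $p(m,n)$ be the number of Fibonacci polyominoes with horizontal semiperimeter $m$ and vertical semiperimeter $n$, and let $P(x,y)=\sum_{m,n\geq 1}p(m,n)x^my^n$. For $n\geq 2$, \[ [y^n]P(x,y)=(1+x)x\sum_{k=0}^{n-2}C_{k+1}\binom{n-2}{k}x^k, \] and $[y]P(x,y)=x$, where $C_k=\frac{1}{k+1}\binom{2k}{k}$ is the $k$th Catalan number.
   Context: A Fibonacci polyomino is a (nonempty) polyomino, considered up to translation, that is column-convex (each column is a contiguous segment of unit cells) and such that, reading columns from left to right, the bottom cell of each column lies exactly one unit above the bottom cell of the preceding column. Equivalently, it is given by a sequence of column heights $(h_1,\dots,h_m)$, $m\ge 1$, with $h_i\ge 2$ for $1\le i\le m-1$ and $h_m\ge 1$; column $i$ consists of the cells in column position $i$ and rows $i,i+1,\dots,i+h_i-1$. The horizontal (resp. vertical) semiperimeter of a polyomino is half the number of horizontal (resp. vertical) unit edges on its boundary (a boundary edge is a unit edge belonging to exactly one cell). $[y^n]P(x,y)$ denotes the coefficient of $y^n$, as a power series in $x$. *)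

theory Defs
  imports Complex_Main "HOL-Computational_Algebra.Formal_Power_Series"
begin

text \<open>The cell \<open>(i, j)\<close> is the unit square with lower left corner \<open>(i, j)\<close>; the first
  coordinate is the column position, the second one the row.\<close>

type_synonym cell = "int \<times> int"

definition adjacent_cells :: "(cell \<times> cell) set" where
  "adjacent_cells = {((i, j), (i', j')). \<bar>i - i'\<bar> + \<bar>j - j'\<bar> = 1}"

definition polyomino :: "cell set \<Rightarrow> bool" where
  "polyomino S \<longleftrightarrow> finite S \<and> S \<noteq> {} \<and>
     (\<forall>c\<in>S. \<forall>d\<in>S. (c, d) \<in> (adjacent_cells \<inter> S \<times> S)\<^sup>*)"

definition column :: "cell set \<Rightarrow> int \<Rightarrow> int set" where
  "column S i = {j. (i, j) \<in> S}"

text \<open>An empty column is \<open>{a..b}\<close> with \<open>b < a\<close>.\<close>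

definition column_convex :: "cell set \<Rightarrow> bool" where
  "column_convex S \<longleftrightarrow> (\<forall>i. \<exists>a b. column S i = {a..b})"

text \<open>The nonempty columns of a polyomino occupy consecutive positions by connectedness, so
  the column preceding column \<open>i + 1\<close> is column \<open>i\<close>.\<close>

definition fibonacci_polyomino :: "cell set \<Rightarrow> bool" where
  "fibonacci_polyomino S \<longleftrightarrow> polyomino S \<and> column_convex S \<and>
     (\<forall>i. column S i \<noteq> {} \<longrightarrow> column S (i + 1) \<noteq> {} \<longrightarrow>
        Min (column S (i + 1)) = Min (column S i) + 1)"

definition translation_rel :: "(cell set \<times> cell set) set" where
  "translation_rel = {(S, T). \<exists>a b. T = (\<lambda>(i, j). (i + a, j + b)) ` S}"

text \<open>A horizontal unit edge is identified with its left endpoint, a vertical one with its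
  lower endpoint.\<close>

definition horizontal_edges :: "cell \<Rightarrow> (int \<times> int) set" where
  "horizontal_edges = (\<lambda>(i, j). {(i, j), (i, j + 1)})"

definition vertical_edges :: "cell \<Rightarrow> (int \<times> int) set" where
  "vertical_edges = (\<lambda>(i, j). {(i, j), (i + 1, j)})"

definition horizontal_semiperimeter :: "cell set \<Rightarrow> rat" where
  "horizontal_semiperimeter S = of_nat (card {e. \<exists>!c. c \<in> S \<and> e \<in> horizontal_edges c}) / 2"

definition vertical_semiperimeter :: "cell set \<Rightarrow> rat" where
  "vertical_semiperimeter S = of_nat (card {e. \<exists>!c. c \<in> S \<and> e \<in> vertical_edges c}) / 2"

definition num_fib_polyominoes :: "nat \<Rightarrow> nat \<Rightarrow> nat" where
  "num_fib_polyominoes m n =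
     card ({S. fibonacci_polyomino S \<and> horizontal_semiperimeter S = of_nat m \<and>
               vertical_semiperimeter S = of_nat n} // translation_rel)"

text \<open>The bivariate series is a power series in \<open>y\<close> whose coefficients are power series
  in \<open>x\<close>.\<close>

definition fib_polyomino_gf :: "rat fps fps" where
  "fib_polyomino_gf =
     Abs_fps (\<lambda>n. Abs_fps (\<lambda>m. if m \<ge> 1 \<and> n \<ge> 1 then of_nat (num_fib_polyominoes m n) else 0))"

definition catalan :: "nat \<Rightarrow> rat" where
  "catalan k = 1 / of_nat (k + 1) * of_nat ((2 * k) choose k)"

end

theory Submission
  imports Defs
begin

text \<open>Half of the vertical boundary edges are left edges, so for heights \<open>h\<^sub>1, \<dots>, h\<^sub>m\<close> the
  horizontal semiperimeter is \<open>m\<close> and the vertical one is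
  \<open>h\<^sub>1 + (\<Sum>i. max 0 (h\<^sub>i\<^sub>+\<^sub>1 + 1 - h\<^sub>i))\<close>. The number of ways to append \<open>m\<close> further unrestricted heights
  to a height \<open>p\<close>, counted by the additional left edges (marked by \<open>y\<close>), is the coefficient series
  \<open>\<Sum>r. T(m, r) (p choose r) v^(m - r)\<close> with \<open>v = y / (1 - y)\<close> and \<open>T\<close> the Catalan triangle: prepending a
  height sends \<open>(p choose r)\<close> to \<open>\<Sum>t\<le>r+1. (p choose t) v^(r + 1 - t)\<close>, which is the recurrence of \<open>T\<close>. At
  \<open>p = 0\<close> only \<open>T(m, 0) v^m\<close> with \<open>T(m, 0) = C\<^sub>m\<close> survives. Subtracting 2 from all heights reduces
  the sequences with \<open>h\<^sub>m \<ge> 2\<close> to this count.\<close>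

subsection \<open>Sequences of column heights\<close>

text \<open>The subtraction is truncated: it counts the left edges contributed by a column of height \<open>h\<close>
  that follows a column of height \<open>p\<close>.\<close>

fun rise :: "nat \<Rightarrow> nat list \<Rightarrow> nat" where
  "rise p [] = 0"
| "rise p (h # hs) = (h + 1 - p) + rise h hs"

lemma rise_conv_sum: "rise p hs = (\<Sum>i<length hs. hs ! i + 1 - (p # hs) ! i)"
proof (induction hs arbitrary: p)
  case (Cons h hs)
  show ?case
    by (simp only: rise.simps Cons.IH length_Cons sum.lessThan_Suc_shift) simp
qed simp

lemma rise_snoc: "rise p (hs @ [h]) = rise p hs + (h + 1 - last (p # hs))"
  by (induction hs arbitrary: p) auto

lemma rise_map_add: "rise (p + c) (map (\<lambda>h. h + c) hs) = rise p hs"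
  by (induction hs arbitrary: p) auto

definition rise_lists :: "nat \<Rightarrow> nat \<Rightarrow> nat \<Rightarrow> nat list set" where
  "rise_lists m p n = {hs. length hs = m \<and> rise p hs = n}"

lemma rise_lists_0: "rise_lists 0 p n = (if n = 0 then {[]} else {})"
  by (auto simp: rise_lists_def)

text \<open>A first height \<open>h\<close> adds \<open>h + 1 - p\<close> left edges, and this is at
  most \<open>n\<close> exactly when \<open>h < n + p\<close>. So the union is finite and the
  subtraction from \<open>n\<close> is exact.\<close>

lemma rise_lists_Suc:
  "rise_lists (Suc m) p n =
     (\<Union>h<n + p. (#) h ` rise_lists m h (n - (h + 1 - p)))" (is "?L = ?R")
proof (intro set_eqI iffI)
  fix hs assume "hs \<in> ?L"
  then obtain h ks where hs: "hs = h # ks" "length ks = m" "n = h + 1 - p + rise h ks"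
    by (cases hs) (auto simp: rise_lists_def)
  then have "h < n + p" "ks \<in> rise_lists m h (n - (h + 1 - p))"
    by (auto simp: rise_lists_def)
  then show "hs \<in> ?R" using hs(1) by blast
next
  fix hs assume "hs \<in> ?R"
  then show "hs \<in> ?L" by (auto simp: rise_lists_def)
qed

lemma finite_rise_lists: "finite (rise_lists m p n)"
  by (induction m arbitrary: p n) (auto simp: rise_lists_0 rise_lists_Suc)

text \<open>First heights \<open>h < p\<close> add no left edge, while \<open>h = p + i\<close> adds
  \<open>i + 1\<close>.\<close>

lemma card_rise_lists_Suc:
  "card (rise_lists (Suc m) p n) =
     (\<Sum>h<p. card (rise_lists m h n)) + (\<Sum>i<n. card (rise_lists m (p + i) (n - Suc i)))"
proof -
  let ?f = "\<lambda>h. card (rise_lists m h (n - (h + 1 - p)))"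
  have "card (rise_lists (Suc m) p n) = (\<Sum>h<n + p. card ((#) h ` rise_lists m h (n - (h + 1 - p))))"
    unfolding rise_lists_Suc by (rule card_UN_disjoint) (auto simp: finite_rise_lists)
  also have "\<dots> = (\<Sum>h<p + n. ?f h)"
    by (intro sum.cong) (auto simp: card_image inj_on_def)
  also have "\<dots> = sum ?f {..<p} + (\<Sum>h=p..<p + n. ?f h)"
    by (subst sum.union_disjoint [symmetric]) (auto intro: sum.cong)
  also have "sum ?f {..<p} = (\<Sum>h<p. card (rise_lists m h n))"
    by (intro sum.cong) auto
  also have "(\<Sum>h=p..<p + n. ?f h) = (\<Sum>i<n. ?f (p + i))"
    by (rule sum.reindex_bij_witness [of _ "\<lambda>i. p + i" "\<lambda>h. h - p"]) auto
  also have "\<dots> = (\<Sum>i<n. card (rise_lists m (p + i) (n - Suc i)))"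
    by simp
  finally show ?thesis .
qed

subsection \<open>Powers of the geometric series and ballot numbers\<close>

text \<open>This is \<open>v = y / (1 - y)\<close>, over the integers because \<open>ballot\<close>
  is a difference.\<close>

definition geom :: "int fps" where
  "geom = Abs_fps (\<lambda>n. if n = 0 then 0 else 1)"

lemma fps_nth_geom_mult: "fps_nth (geom * f) n = (\<Sum>i<n. fps_nth f i)"
proof -
  have "fps_nth (f * geom) n = (\<Sum>i=0..n. if i < n then fps_nth f i else 0)"
    by (auto simp: fps_mult_nth geom_def intro!: sum.cong)
  also have "\<dots> = (\<Sum>i<n. fps_nth f i)"
    by (intro sum.mono_neutral_cong_right) auto
  finally show ?thesis by (simp add: mult.commute)
qed

lemma sum_lessThan_choose: "(\<Sum>i<n. i choose r) = n choose Suc r"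
  by (induction n) auto

lemma fps_nth_geom_power_0: "fps_nth (geom ^ Suc s) 0 = 0"
  by (simp add: geom_def)

text \<open>Each further factor takes partial sums, and the hockey-stick identity then raises the
  lower index of the binomial by one.\<close>

lemma fps_nth_geom_power_Suc: "fps_nth (geom ^ Suc s) (Suc n) = int (n choose s)"
proof (induction s arbitrary: n)
  case 0
  show ?case by (simp add: geom_def)
next
  case (Suc s)
  have "fps_nth (geom ^ Suc (Suc s)) (Suc n) = (\<Sum>i<n. fps_nth (geom ^ Suc s) (Suc i))"
    by (simp only: power_Suc [of geom "Suc s"] fps_nth_geom_mult sum.lessThan_Suc_shift
        fps_nth_geom_power_0 add_0)
  also have "\<dots> = int (\<Sum>i<n. i choose s)"
    by (simp only: Suc.IH of_nat_sum)
  finally show ?case by (simp only: sum_lessThan_choose)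
qed

text \<open>As \<open>i choose s\<close> is the coefficient of \<open>y^(i + 1)\<close> in
  \<open>geom ^ (s + 1)\<close>, the sum is a Cauchy product; the missing term vanishes since
  \<open>geom ^ (s + 1)\<close> has no constant term.\<close>

lemma sum_choose_geom_power:
  "(\<Sum>i<n. int (i choose s) * fps_nth (geom ^ q) (n - Suc i)) = fps_nth (geom ^ (s + q + 1)) n"
proof (cases n)
  case 0
  then show ?thesis using fps_nth_geom_power_0 [of "s + q"] by simp
next
  case (Suc k)
  have "fps_nth (geom ^ (s + q + 1)) n = fps_nth (geom ^ Suc s * geom ^ q) n"
    by (simp add: power_add mult_ac)
  also have "\<dots> = (\<Sum>i\<le>Suc k. fps_nth (geom ^ Suc s) i * fps_nth (geom ^ q) (n - i))"
    by (simp only: fps_mult_nth Suc atMost_atLeast0)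
  also have "\<dots> = (\<Sum>i<n. int (i choose s) * fps_nth (geom ^ q) (n - Suc i))"
    by (simp only: sum.atMost_Suc_shift fps_nth_geom_power_0 fps_nth_geom_power_Suc Suc
        lessThan_Suc_atMost mult_zero_left add_0 diff_Suc_Suc)
  finally show ?thesis by simp
qed

text \<open>The Catalan triangle in the form given by the reflection principle: for
  \<open>r <= m\<close> it counts the paths with \<open>m\<close> up steps and \<open>m - r\<close>
  down steps that never go below their start.\<close>

definition ballot :: "nat \<Rightarrow> nat \<Rightarrow> int" where
  "ballot m r = int ((2 * m - r) choose m) - int ((2 * m - r) choose Suc m)"

text \<open>Pascal's rule, which amounts to removing the last step of a path, gives
  \<open>T(m + 1, t + 1) = T(m, t) + T(m + 1, t + 2)\<close>. Downward induction on \<open>t\<close>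
  iterates this.\<close>

lemma ballot_Suc_Suc: 
  assumes "t \<le> m" shows "ballot (Suc m) (Suc t) = (\<Sum>r=t..m. ballot m r)"
  using assms
proof (induction rule: inc_induct)
  case base
  show ?case by (simp add: ballot_def)
next
  case (step t)
  have "2 * Suc m - Suc t = Suc (2 * Suc m - Suc (Suc t))" using step.hyps by simp
  moreover have "2 * Suc m - Suc (Suc t) = 2 * m - t" using step.hyps by simp
  ultimately have "ballot (Suc m) (Suc t) = ballot m t + ballot (Suc m) (Suc (Suc t))"
    unfolding ballot_def by simp
  then show ?case using step.hyps by (simp add: step.IH sum.atLeast_Suc_atMost)
qed

text \<open>A path back to its starting level must end with a down step, so
  \<open>T(m + 1, 0) = T(m + 1, 1)\<close>; in binomials this is Pascal's rule with
  symmetry.\<close>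

lemma ballot_Suc_0: "ballot (Suc m) 0 = (\<Sum>r=0..m. ballot m r)"
proof -
  have "(2 * m + 1) choose m = (2 * m + 1) choose Suc m"
    by (subst binomial_symmetric) auto
  then have "ballot (Suc m) 0 = ballot (Suc m) (Suc 0)"
    by (simp add: ballot_def)
  then show ?thesis by (simp add: ballot_Suc_Suc)
qed

text \<open>By absorption, the subtracted binomial is \<open>m / (m + 1)\<close> times the central
  one.\<close>

lemma ballot_0_eq_catalan: "of_int (ballot m 0) = catalan m"
proof -
  have "Suc m * ((2 * m) choose Suc m) = m * ((2 * m) choose m)"
    using binomial_absorb_comp [of "2 * m" m] binomial_absorption [of m "2 * m"]
    by (simp del: binomial_Suc_Suc mult_Suc) (metis mult_1 One_nat_def)
  then have "of_nat (Suc m) * (of_nat ((2 * m) choose Suc m) :: rat) = of_nat m * of_nat ((2 * m) choose m)"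
    by (metis of_nat_mult)
  then show ?thesis
    by (simp add: ballot_def catalan_def field_simps)
qed

section \<open>Height sequences counted by ballot numbers\<close>

lemma card_rise_lists:
  "int (card (rise_lists m p n)) =
     (\<Sum>r\<le>m. ballot m r * int (p choose r) * fps_nth (geom ^ (m - r)) n)"
proof (induction m arbitrary: p n)
  case 0
  show ?case by (simp add: rise_lists_0 ballot_def)
next
  case (Suc m)
  define g where "g r = fps_nth (geom ^ r) n" for r
  define b where "b t = int (p choose t)" for t
  \<comment> \<open>By the hockey-stick identity the heights below \<open>p\<close> supply the term
    \<open>t = r + 1\<close>, whose exponent is \<open>Suc m - (r + 1) = m - r\<close>.\<close>
  have low: "(\<Sum>h<p. int (card (rise_lists m h n))) = (\<Sum>r\<le>m. ballot m r * (b (Suc r) * g (m - r)))"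
  proof -
    have "(\<Sum>h<p. int (card (rise_lists m h n))) =
      (\<Sum>r\<le>m. \<Sum>h<p. ballot m r * int (h choose r) * g (m - r))"
      by (simp only: Suc.IH g_def) (rule sum.swap)
    also have "\<dots> = (\<Sum>r\<le>m. ballot m r * (int (\<Sum>h<p. h choose r) * g (m - r)))"
      by (simp add: sum_distrib_left sum_distrib_right mult_ac)
    finally show ?thesis by (simp only: sum_lessThan_choose b_def)
  qed
  have high: "(\<Sum>i<n. int (card (rise_lists m (p + i) (n - Suc i)))) =
      (\<Sum>r\<le>m. ballot m r * (\<Sum>t\<le>r. b t * g (Suc m - t)))"
  proof -
    \<comment> \<open>Vandermonde splits \<open>(p + i) choose r\<close>. The convolution over
      \<open>i\<close> then has exponent \<open>(r - t) + (m - r) + 1 = Suc m - t\<close>.\<close>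
    have *: "(\<Sum>i<n. int ((p + i) choose r) * fps_nth (geom ^ (m - r)) (n - Suc i)) =
        (\<Sum>t\<le>r. b t * g (Suc m - t))" if "r \<le> m" for r
    proof -
      have "(\<Sum>i<n. int ((p + i) choose r) * fps_nth (geom ^ (m - r)) (n - Suc i)) =
          (\<Sum>i<n. \<Sum>t\<le>r. b t * (int (i choose (r - t)) * fps_nth (geom ^ (m - r)) (n - Suc i)))"
        by (simp add: vandermonde [symmetric] b_def sum_distrib_left sum_distrib_right mult_ac)
      also have "\<dots> = (\<Sum>t\<le>r. b t * (\<Sum>i<n. int (i choose (r - t)) * fps_nth (geom ^ (m - r)) (n - Suc i)))"
        by (subst sum.swap) (simp add: sum_distrib_left)
      also have "\<dots> = (\<Sum>t\<le>r. b t * g (Suc m - t))"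
        unfolding sum_choose_geom_power g_def
        using that by (intro sum.cong refl arg_cong2 [where f = "(*)"] arg_cong2 [where f = fps_nth] 
            arg_cong2 [where f = power]) auto
      finally show ?thesis .
    qed
    have "(\<Sum>i<n. int (card (rise_lists m (p + i) (n - Suc i)))) =
      (\<Sum>r\<le>m. \<Sum>i<n. ballot m r * int ((p + i) choose r) * fps_nth (geom ^ (m - r)) (n - Suc i))"
      by (simp only: Suc.IH) (rule sum.swap)
    also have "\<dots> = (\<Sum>r\<le>m. ballot m r * (\<Sum>t\<le>r. b t * g (Suc m - t)))"
      by (intro sum.cong refl) (simp add: * [symmetric] sum_distrib_left mult_ac)
    finally show ?thesis .
  qed
  have "int (card (rise_lists (Suc m) p n)) =
      (\<Sum>r\<le>m. ballot m r * (\<Sum>t\<le>Suc r. b t * g (Suc m - t)))"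
    by (simp only: card_rise_lists_Suc of_nat_add of_nat_sum low high)
      (simp add: sum.distrib [symmetric] distrib_left add.commute)
  \<comment> \<open>The term \<open>t = 0\<close> is split off: its coefficient is the full row sum
    of \<open>ballot_Suc_0\<close>, while the others are the tails in \<open>ballot_Suc_Suc\<close>,
    obtained by exchanging the sums.\<close>
  also have "\<dots> = (\<Sum>r\<le>m. ballot m r * (b 0 * g (Suc m))) +
      (\<Sum>r\<le>m. \<Sum>t\<le>r. ballot m r * (b (Suc t) * g (m - t)))"
    by (simp only: sum.atMost_Suc_shift)
      (simp add: sum.distrib [symmetric] algebra_simps sum_distrib_left)
  also have "(\<Sum>r\<le>m. \<Sum>t\<le>r. ballot m r * (b (Suc t) * g (m - t))) =
      (\<Sum>t\<le>m. \<Sum>r=t..m. ballot m r * (b (Suc t) * g (m - t)))"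
    by (subst (1 2) sum.Sigma, simp_all)
      (rule sum.reindex_bij_witness [of _ "\<lambda>(t, r). (r, t)" "\<lambda>(r, t). (t, r)"], auto)
  also have "\<dots> = (\<Sum>t\<le>m. ballot (Suc m) (Suc t) * (b (Suc t) * g (m - t)))"
    by (intro sum.cong refl) (simp add: ballot_Suc_Suc sum_distrib_right)
  also have "(\<Sum>r\<le>m. ballot m r * (b 0 * g (Suc m))) = ballot (Suc m) 0 * (b 0 * g (Suc m))"
    by (simp add: ballot_Suc_0 sum_distrib_right atMost_atLeast0)
  also have "\<dots> + (\<Sum>t\<le>m. ballot (Suc m) (Suc t) * (b (Suc t) * g (m - t))) =
      (\<Sum>t\<le>Suc m. ballot (Suc m) t * (b t * g (Suc m - t)))"
    by (simp only: sum.atMost_Suc_shift) simp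
  finally show ?case by (simp add: b_def g_def mult_ac del: sum.atMost_Suc)
qed

lemma card_rise_lists_0: "int (card (rise_lists m 0 n)) = ballot m 0 * fps_nth (geom ^ m) n"
proof -
  have "int (card (rise_lists m 0 n)) =
      (\<Sum>r\<le>m. if r = 0 then ballot m 0 * fps_nth (geom ^ m) n else 0)"
    unfolding card_rise_lists by (intro sum.cong) auto
  then show ?thesis by simp
qed

subsection \<open>Counting Fibonacci height sequences\<close>

definition fib_heights :: "nat list \<Rightarrow> bool" where
  "fib_heights hs \<longleftrightarrow> hs \<noteq> [] \<and> (\<forall>h\<in>set (butlast hs). 2 \<le> h) \<and> 1 \<le> last hs"

lemma fib_heights_iff_nth:
  "fib_heights hs \<longleftrightarrow> hs \<noteq> [] \<and> (\<forall>i<length hs. 1 \<le> hs ! i) \<and>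
     (\<forall>i. Suc i < length hs \<longrightarrow> 2 \<le> hs ! i)"
proof (cases hs rule: rev_cases)
  case (snoc ys y)
  show ?thesis
    unfolding fib_heights_def snoc
    by (auto simp: all_set_conv_all_nth nth_append All_less_Suc intro: order_trans [of _ 2])
qed (simp add: fib_heights_def)

text \<open>The start value 1 lets the first column count in full, as
  \<open>h + 1 - 1 = h\<close>.\<close>

definition fib_lists :: "nat \<Rightarrow> nat \<Rightarrow> nat list set" where
  "fib_lists m n = {hs. fib_heights hs \<and> length hs = m \<and> rise 1 hs = n}"

definition tall_lists :: "nat \<Rightarrow> nat \<Rightarrow> nat list set" where
  "tall_lists m n = {hs. (\<forall>h\<in>set hs. 2 \<le> h) \<and> length hs = m \<and> rise 1 hs = n}"

text \<open>The first height contributes \<open>h + 2\<close> on the left and \<open>h + 1\<close>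
  on the right; later contributions depend only on differences of heights.\<close>

lemma rise_1_map_add_2: "hs \<noteq> [] \<Longrightarrow> rise 1 (map (\<lambda>h. h + 2) hs) = Suc (rise 0 hs)"
  by (cases hs) (use rise_map_add [where c = 2] in auto)

lemma tall_lists_eq:
  assumes "m \<ge> 1" "n \<ge> 1"
  shows "tall_lists m n = map (\<lambda>h. h + 2) ` rise_lists m 0 (n - 1)"
proof (intro set_eqI iffI)
  fix hs assume hs: "hs \<in> tall_lists m n"
  define js where "js = map (\<lambda>h. h - 2) hs"
  have eq: "hs = map (\<lambda>h. h + 2) js"
    using hs by (auto simp: js_def tall_lists_def intro!: map_idI [symmetric])
  have "js \<noteq> []" using hs assms by (auto simp: tall_lists_def js_def)
  then have "js \<in> rise_lists m 0 (n - 1)"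
    using hs rise_1_map_add_2 [of js] by (auto simp: eq tall_lists_def rise_lists_def)
  then show "hs \<in> map (\<lambda>h. h + 2) ` rise_lists m 0 (n - 1)" using eq by blast
next
  fix hs assume "hs \<in> map (\<lambda>h. h + 2) ` rise_lists m 0 (n - 1)"
  then obtain js where "hs = map (\<lambda>h. h + 2) js" "length js = m" "rise 0 js = n - 1"
    by (auto simp: rise_lists_def)
  moreover have "js \<noteq> []" using calculation assms by auto
  ultimately show "hs \<in> tall_lists m n"
    using assms rise_1_map_add_2 [of js] by (auto simp: tall_lists_def)
qed

lemma finite_tall_lists: "m \<ge> 1 \<Longrightarrow> n \<ge> 1 \<Longrightarrow> finite (tall_lists m n)"
  by (simp add: tall_lists_eq finite_rise_lists)

lemma card_tall_lists:
  assumes "m \<ge> 1" "n \<ge> 1"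
  shows "of_nat (card (tall_lists m n)) =
    (if n = 1 then 0 else catalan m * of_nat ((n - 2) choose (m - 1)))"
proof -
  have "card (tall_lists m n) = card (rise_lists m 0 (n - 1))"
    unfolding tall_lists_eq [OF assms] by (intro card_image inj_on_mapI) (auto simp: inj_on_def)
  then have "(of_nat (card (tall_lists m n)) :: rat) = of_int (int (card (rise_lists m 0 (n - 1))))"
    by simp
  also have "\<dots> = catalan m * of_int (fps_nth (geom ^ m) (n - 1))"
    by (simp only: card_rise_lists_0 of_int_mult ballot_0_eq_catalan)
  \<comment> \<open>For \<open>n = 1\<close> this is a constant term, hence 0. The case is separate
    because the truncated \<open>n - 2\<close> would give 1 for \<open>m = 1\<close>.\<close>
  also have "fps_nth (geom ^ m) (n - 1) = (if n = 1 then 0 else int ((n - 2) choose (m - 1)))"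
    using assms fps_nth_geom_power_0 [of "m - 1"] fps_nth_geom_power_Suc [of "m - 1" "n - 2"]
    by (auto simp: Suc_diff_Suc numeral_2_eq_2)
  finally show ?thesis by simp
qed

text \<open>A last column of height 1 after a column of height at least 2 adds no left edge; this is the
  factor \<open>1 + x\<close>.\<close>

lemma fib_lists_Suc:
  "fib_lists (Suc m) n = tall_lists (Suc m) n \<union>
     (\<lambda>hs. hs @ [1]) ` (if m = 0 then (if n = 1 then {[]} else {}) else tall_lists m n)"
  (is "_ = _ \<union> ?B")
proof (intro set_eqI)
  fix hs :: "nat list"
  show "hs \<in> fib_lists (Suc m) n \<longleftrightarrow> hs \<in> tall_lists (Suc m) n \<union> ?B"
  proof (cases hs rule: rev_cases)
    case Nil
    then show ?thesis by (auto simp: fib_lists_def tall_lists_def)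
  next
    case (snoc ys y)
    \<comment> \<open>A lone column of height 1 does add a left edge, hence the special case
      \<open>m = 0\<close>.\<close>
    have "rise 1 (ys @ [1]) = (if ys = [] then 1 else rise 1 ys)" if "\<forall>h\<in>set ys. 2 \<le> h"
      using that by (auto simp: rise_snoc Suc_le_eq less_eq_Suc_le [symmetric] numeral_2_eq_2)
    then have "y = 1 \<Longrightarrow> ?thesis"
      unfolding snoc by (auto simp: fib_lists_def tall_lists_def fib_heights_def)
    moreover have "y \<noteq> 1 \<Longrightarrow> ?thesis"
      unfolding snoc by (auto simp: fib_lists_def tall_lists_def fib_heights_def)
    ultimately show ?thesis by blast
  qed
qed

lemma card_fib_lists_Suc:
  assumes "n \<ge> 1"
  shows "card (fib_lists (Suc m) n) = card (tall_lists (Suc m) n) +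
    (if m = 0 then (if n = 1 then 1 else 0) else card (tall_lists m n))"
proof -
  let ?A = "if m = 0 then (if n = 1 then {[]} else {}) else tall_lists m n"
  have "card (fib_lists (Suc m) n) = card (tall_lists (Suc m) n) + card ((\<lambda>hs. hs @ [1]) ` ?A)"
    unfolding fib_lists_Suc using assms
    by (intro card_Un_disjoint) (auto simp: finite_tall_lists, auto simp: tall_lists_def)
  also have "card ((\<lambda>hs. hs @ [1]) ` ?A) = card ?A"
    by (intro card_image) (auto simp: inj_on_def)
  finally show ?thesis by simp
qed

subsection \<open>Boundary edges\<close>

lemma card_Diff_swap:
  assumes "finite A" "finite B" "card A = card B"
  shows "card (A - B) = card (B - A)"
  using assms by (simp add: card_Diff_subset_Int Int_commute)

text \<open>Each cell \<open>c\<close> carries the two edges \<open>c\<close> and \<open>g c\<close>; boundary edges of the two kinds are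
  equinumerous.\<close>

lemma card_boundary_edges:
  assumes "finite S" "inj g" "\<And>c. g c \<noteq> c"
  shows "card {e. \<exists>!c. c \<in> S \<and> (e = c \<or> e = g c)} = 2 * card (S - g ` S)"
proof -
  have eq: "{e. \<exists>!c. c \<in> S \<and> (e = c \<or> e = g c)} = (S - g ` S) \<union> (g ` S - S)"
  proof (intro set_eqI iffI)
    fix e assume "e \<in> {e. \<exists>!c. c \<in> S \<and> (e = c \<or> e = g c)}"
    then show "e \<in> (S - g ` S) \<union> (g ` S - S)"
      using assms(3) by auto
  next
    fix e assume "e \<in> (S - g ` S) \<union> (g ` S - S)"
    then show "e \<in> {e. \<exists>!c. c \<in> S \<and> (e = c \<or> e = g c)}"
      using injD [OF assms(2)] by blast
  qed
  have "card (g ` S - S) = card (S - g ` S)"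
    using assms by (intro card_Diff_swap) (auto simp: card_image inj_on_subset)
  then show ?thesis
    unfolding eq using assms by (subst card_Un_disjoint) auto
qed

section \<open>Translations and semiperimeters\<close>

definition shift :: "int \<Rightarrow> int \<Rightarrow> cell \<Rightarrow> cell" where
  "shift a b = (\<lambda>(i, j). (i + a, j + b))"

lemma shift_simp [simp]: "shift a b (i, j) = (i + a, j + b)"
  by (simp add: shift_def)

lemma mem_shift_image_iff: "(i, j) \<in> shift a b ` S \<longleftrightarrow> (i - a, j - b) \<in> S"
  by (force simp: image_iff)

lemma inj_shift: "inj (shift a b)"
  by (auto simp: inj_def)

lemma shift_shift_image: "shift a b ` shift c d ` S = shift (a + c) (b + d) ` S"
  by (auto simp: image_image algebra_simps image_iff shift_def case_prod_beta)

text \<open>The horizontal edges of \<open>c\<close> are \<open>c\<close> and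
  \<open>shift 0 1 c\<close>, so it suffices to count the cells with no cell below.\<close>

lemma horizontal_semiperimeter_eq:
  assumes "finite S"
  shows "horizontal_semiperimeter S = of_nat (card (S - shift 0 1 ` S))"
proof -
  have "{e. \<exists>!c. c \<in> S \<and> e \<in> horizontal_edges c} = {e. \<exists>!c. c \<in> S \<and> (e = c \<or> e = shift 0 1 c)}"
    by (simp add: horizontal_edges_def shift_def case_prod_beta)
  also have "card \<dots> = 2 * card (S - shift 0 1 ` S)"
    using assms by (intro card_boundary_edges inj_shift) (auto simp: shift_def case_prod_beta prod_eq_iff)
  finally show ?thesis by (simp add: horizontal_semiperimeter_def)
qed

text \<open>Likewise with \<open>shift 1 0\<close>, counting the cells with no left
  neighbour.\<close>

lemma vertical_semiperimeter_eq:
  assumes "finite S"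
  shows "vertical_semiperimeter S = of_nat (card (S - shift 1 0 ` S))"
proof -
  have "{e. \<exists>!c. c \<in> S \<and> e \<in> vertical_edges c} = {e. \<exists>!c. c \<in> S \<and> (e = c \<or> e = shift 1 0 c)}"
    by (simp add: vertical_edges_def shift_def case_prod_beta)
  also have "card \<dots> = 2 * card (S - shift 1 0 ` S)"
    using assms by (intro card_boundary_edges inj_shift) (auto simp: shift_def case_prod_beta prod_eq_iff)
  finally show ?thesis by (simp add: vertical_semiperimeter_def)
qed

text \<open>Translations commute and are injective.\<close>

lemma card_shift_Diff:
  "card (shift a b ` S - shift c d ` shift a b ` S) = card (S - shift c d ` S)"
proof -
  have "shift a b ` S - shift c d ` shift a b ` S = shift a b ` (S - shift c d ` S)"
    by (simp add: image_set_diff [OF inj_shift] shift_shift_image add.commute)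
  then show ?thesis by (simp add: card_image inj_on_subset [OF inj_shift])
qed

lemma semiperimeter_shift:
  assumes "finite S"
  shows "horizontal_semiperimeter (shift a b ` S) = horizontal_semiperimeter S"
    and "vertical_semiperimeter (shift a b ` S) = vertical_semiperimeter S"
  using assms
  by (simp_all only: horizontal_semiperimeter_eq vertical_semiperimeter_eq finite_imageI card_shift_Diff)

subsection \<open>The polyomino of a height sequence\<close>

definition fib_cells :: "nat list \<Rightarrow> cell set" where
  "fib_cells hs = (\<Union>k<length hs. {int k} \<times> {int k..<int k + int (hs ! k)})"

lemma finite_fib_cells: "finite (fib_cells hs)"
  by (auto simp: fib_cells_def)

lemma mem_fib_cells:
  "(i, j) \<in> fib_cells hs \<longleftrightarrow> 0 \<le> i \<and> i < int (length hs) \<and> i \<le> j \<and> j < i + int (hs ! nat i)"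
proof
  assume "0 \<le> i \<and> i < int (length hs) \<and> i \<le> j \<and> j < i + int (hs ! nat i)"
  then show "(i, j) \<in> fib_cells hs"
    by (auto simp: fib_cells_def intro!: bexI [of _ "nat i"])
qed (auto simp: fib_cells_def)

lemma column_fib_cells:
  "column (fib_cells hs) i =
     (if 0 \<le> i \<and> i < int (length hs) then {i..<i + int (hs ! nat i)} else {})"
  by (auto simp: column_def mem_fib_cells)

text \<open>Only the bottom cell \<open>(k, k)\<close> of each column has no cell below.\<close>

lemma horizontal_semiperimeter_fib_cells:
  assumes "fib_heights hs"
  shows "horizontal_semiperimeter (fib_cells hs) = of_nat (length hs)"
proof -
  have "fib_cells hs - shift 0 1 ` fib_cells hs = (\<lambda>k. (int k, int k)) ` {..<length hs}"
  proof (intro set_eqI, clarify)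
    fix i j
    show "(i, j) \<in> fib_cells hs - shift 0 1 ` fib_cells hs \<longleftrightarrow>
        (i, j) \<in> (\<lambda>k. (int k, int k)) ` {..<length hs}"
    proof (cases "0 \<le> i \<and> i < int (length hs)")
      case True
      then obtain k where k: "i = int k" "k < length hs"
        by (metis nat_0_le of_nat_less_iff)
      then have "1 \<le> hs ! k" using assms by (auto simp: fib_heights_iff_nth)
      then show ?thesis using k by (auto simp: mem_shift_image_iff mem_fib_cells)
    qed (auto simp: mem_fib_cells)
  qed
  then show ?thesis
    by (simp add: horizontal_semiperimeter_eq finite_fib_cells card_image inj_on_def)
qed

lemma vertical_semiperimeter_fib_cells:
  assumes "fib_heights hs"
  shows "vertical_semiperimeter (fib_cells hs) = of_nat (rise 1 hs)"
proof -
  \<comment> \<open>The cells of column \<open>k\<close> above the top of column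
    \<open>k - 1\<close>, whose first free row is \<open>k - 1 + hs ! (k - 1)\<close>. The prepended
    1 makes \<open>?E 0\<close> all of column 0.\<close>
  let ?E = "\<lambda>k. {int k} \<times> {int k + int ((1 # hs) ! k) - 1..<int k + int (hs ! k)}"
  have "fib_cells hs - shift 1 0 ` fib_cells hs = (\<Union>k<length hs. ?E k)"
  proof (intro set_eqI, clarify)
    fix i j
    show "(i, j) \<in> fib_cells hs - shift 1 0 ` fib_cells hs \<longleftrightarrow> (i, j) \<in> (\<Union>k<length hs. ?E k)"
    proof (cases "0 \<le> i \<and> i < int (length hs)")
      case True
      then obtain k where k: "i = int k" "k < length hs"
        by (metis nat_0_le of_nat_less_iff)
      have "(i, j) \<in> (\<Union>k<length hs. ?E k) \<longleftrightarrow> (i, j) \<in> ?E k"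
        using k by auto
      also have "\<dots> \<longleftrightarrow> (i, j) \<in> fib_cells hs - shift 1 0 ` fib_cells hs"
      proof (cases k)
        case 0
        then show ?thesis using k by (auto simp: mem_shift_image_iff mem_fib_cells)
      next
        case (Suc l)
        then have "1 \<le> hs ! l" using assms k by (auto simp: fib_heights_iff_nth)
        moreover have "nat (1 + int l) = Suc l" by simp
        ultimately show ?thesis using k Suc by (auto simp: mem_shift_image_iff mem_fib_cells)
      qed
      finally show ?thesis by blast
    qed (auto simp: mem_fib_cells)
  qed
  then have "card (fib_cells hs - shift 1 0 ` fib_cells hs) = card (\<Union>k<length hs. ?E k)"
    by (rule arg_cong)
  also have "\<dots> = (\<Sum>k<length hs. card (?E k))"
    by (rule card_UN_disjoint) auto
  also have "\<dots> = (\<Sum>k<length hs. hs ! k + 1 - (1 # hs) ! k)"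
    by (intro sum.cong refl) (auto simp: card_cartesian_product nat_diff_distrib')
  finally show ?thesis
    by (simp add: vertical_semiperimeter_eq finite_fib_cells rise_conv_sum)
qed

lemma adjacent_cells_commute: "(c, d) \<in> adjacent_cells \<longleftrightarrow> (d, c) \<in> adjacent_cells"
  by (auto simp: adjacent_cells_def abs_minus_commute split: prod.splits)

text \<open>From \<open>(k, k)\<close> one climbs within the column, or passes through
  \<open>(k, k + 1)\<close>, present since a non-last height is at least 2, to
  \<open>(k + 1, k + 1)\<close>.\<close>

lemma fib_cells_reachable:
  assumes "fib_heights hs" "(int k, int k + int l) \<in> fib_cells hs"
  shows "((0, 0), (int k, int k + int l)) \<in> (adjacent_cells \<inter> fib_cells hs \<times> fib_cells hs)\<^sup>*"
    (is "_ \<in> ?R\<^sup>*")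
  using assms(2)
proof (induction k arbitrary: l)
  have up: "((0, 0), (int k, int k + int l)) \<in> ?R\<^sup>*"
    if "((0, 0), (int k, int k)) \<in> ?R\<^sup>*" "(int k, int k + int l) \<in> fib_cells hs" for k l
    using that(2)
  proof (induction l)
    case (Suc l)
    then have *: "(int k, int k + int l) \<in> fib_cells hs" by (auto simp: mem_fib_cells)
    then have "((int k, int k + int l), (int k, int k + int (Suc l))) \<in> ?R"
      using Suc.prems by (auto simp: adjacent_cells_def)
    with Suc.IH [OF *] show ?case by (rule rtrancl_into_rtrancl)
  qed (use that in simp)
  {
    case 0
    then show ?case using up [of 0] by simp
  next
    case (Suc k)
    have "2 \<le> hs ! k" using Suc.prems assms(1) by (auto simp: mem_fib_cells fib_heights_iff_nth)
    then have 1: "(int k, int k + int 1) \<in> fib_cells hs"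
      using Suc.prems by (auto simp: mem_fib_cells)
    have "(int (Suc k), int (Suc k)) \<in> fib_cells hs"
      using Suc.prems by (auto simp: mem_fib_cells)
    then have "((int k, int k + int 1), (int (Suc k), int (Suc k))) \<in> ?R"
      using 1 by (auto simp: adjacent_cells_def)
    with Suc.IH [OF 1] have "((0, 0), (int (Suc k), int (Suc k))) \<in> ?R\<^sup>*"
      by (rule rtrancl_into_rtrancl)
    then show ?case using Suc.prems by (rule up)
  }
qed

lemma fibonacci_polyomino_fib_cells:
  assumes "fib_heights hs"
  shows "fibonacci_polyomino (fib_cells hs)"
proof -
  let ?R = "adjacent_cells \<inter> fib_cells hs \<times> fib_cells hs"
  have reach: "((0, 0), c) \<in> ?R\<^sup>*" if c: "c \<in> fib_cells hs" for c
  proof -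
    obtain i j where ij: "c = (i, j)" by fastforce
    then have "c = (int (nat i), int (nat i) + int (nat (j - i)))"
      using c by (auto simp: mem_fib_cells)
    then show ?thesis using fib_cells_reachable [OF assms] c by metis
  qed
  have "sym ?R" by (auto simp: sym_def adjacent_cells_commute)
  then have "sym (?R\<^sup>*)" by (rule sym_rtrancl)
  then have "(c, d) \<in> ?R\<^sup>*" if "c \<in> fib_cells hs" "d \<in> fib_cells hs" for c d
    using reach that by (meson rtrancl_trans symD)
  moreover have "(0, 0) \<in> fib_cells hs"
    using assms by (auto simp: mem_fib_cells fib_heights_iff_nth)
  ultimately have "polyomino (fib_cells hs)"
    by (auto simp: polyomino_def finite_fib_cells)
  moreover have "column_convex (fib_cells hs)"
    unfolding column_convex_def
  proof
    fix i
    \<comment> \<open>Outside the polyomino, the upper bound \<open>i - 1\<close> gives an empty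
      interval.\<close>
    show "\<exists>a b. column (fib_cells hs) i = {a..b}"
      by (rule exI [of _ i], rule exI [of _ "if 0 \<le> i \<and> i < int (length hs) then i + int (hs ! nat i) - 1 else i - 1"])
        (auto simp: column_fib_cells)
  qed
  moreover have "Min (column (fib_cells hs) i) = i" if "column (fib_cells hs) i \<noteq> {}" for i
    using that by (intro Min_eqI) (auto simp: column_fib_cells split: if_splits)
  ultimately show ?thesis by (auto simp: fibonacci_polyomino_def)
qed

text \<open>Both sets contain \<open>(0, 0)\<close> and satisfy \<open>0 <= i <= j\<close>. Since
  \<open>(a, b)\<close> lies in one and \<open>(- a, - b)\<close> in the other, the shift is
  trivial, and the heights can be read off the cells.\<close>

lemma fib_cells_shift_eqD:
  assumes "fib_heights hs" "fib_heights hs'" "fib_cells hs' = shift a b ` fib_cells hs"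
  shows "hs = hs'"
proof -
  have mem: "(i, j) \<in> fib_cells hs' \<longleftrightarrow> (i - a, j - b) \<in> fib_cells hs" for i j
    by (simp add: assms(3) mem_shift_image_iff)
  have "(0, 0) \<in> fib_cells hs" "(0, 0) \<in> fib_cells hs'"
    using assms(1,2) by (auto simp: mem_fib_cells fib_heights_iff_nth)
  then have "(a, b) \<in> fib_cells hs'" "(- a, - b) \<in> fib_cells hs"
    using mem [of a b] mem [of 0 0] by auto
  then have ab: "a = 0" "0 \<le> b" "b \<le> 0" by (auto simp: mem_fib_cells)
  then have eq: "fib_cells hs' = fib_cells hs" using mem by auto
  have *: "k < length hs \<and> l < hs ! k \<longleftrightarrow> (int k, int k + int l) \<in> fib_cells hs" for k l hs
    by (auto simp: mem_fib_cells)
  \<comment> \<open>Positive heights let the cells determine the length of the list.\<close>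
  have pos: "k < length hs \<longleftrightarrow> k < length hs \<and> 0 < hs ! k" if "fib_heights hs" for k hs
    using that by (auto simp: fib_heights_iff_nth Suc_le_eq)
  have "k < length hs \<longleftrightarrow> k < length hs'" for k
    using pos [OF assms(1)] pos [OF assms(2)] * eq by metis
  then have len: "length hs = length hs'" by (metis less_irrefl linorder_neqE_nat)
  show ?thesis
  proof (rule nth_equalityI [OF len])
    fix k assume "k < length hs"
    then have "l < hs ! k \<longleftrightarrow> l < hs' ! k" for l
      using * [of k hs l] * [of k hs' l] eq len by simp
    then show "hs ! k = hs' ! k" by (metis less_irrefl linorder_neqE_nat)
  qed
qed

section \<open>Recovering the height sequence\<close>

text \<open>Some step of the path passes from column \<open>k\<close> to \<open>k + 1\<close>, and
  adjacency keeps it in one row.\<close>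

lemma reachable_crosses_column:
  assumes "(c, d) \<in> (adjacent_cells \<inter> S \<times> S)\<^sup>*" "fst c \<le> k" "k < fst d"
  obtains j where "(k, j) \<in> S" "(k + 1, j) \<in> S"
proof -
  have "fst d \<le> k \<or> (\<exists>j. (k, j) \<in> S \<and> (k + 1, j) \<in> S)"
    using assms(1)
  proof (induction rule: rtrancl_induct)
    case base
    then show ?case using assms by simp
  next
    case (step d e)
    show ?case
    proof (cases "fst d \<le> k \<and> k < fst e")
      case True
      then have "d = (k, snd d)" "e = (k + 1, snd d)"
        using step.hyps by (auto simp: adjacent_cells_def)
      then show ?thesis using step.hyps by (metis IntD2 SigmaE2)
    qed (use step.IH in auto)
  qed
  then show ?thesis using assms that by auto
qed

text \<open>Connectedness gives neighbouring columns a common row. So no column between the first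
  and the last is empty, and the heights are \<open>hi - lo + 1\<close>.\<close>

lemma fibonacci_polyomino_is_shifted_fib_cells:
  assumes "fibonacci_polyomino S"
  obtains hs a b where "fib_heights hs" "S = shift a b ` fib_cells hs"
proof -
  have fin: "finite S" and ne: "S \<noteq> {}"
    and conn: "\<And>c d. c \<in> S \<Longrightarrow> d \<in> S \<Longrightarrow> (c, d) \<in> (adjacent_cells \<inter> S \<times> S)\<^sup>*"
    and convex: "\<And>i. \<exists>a b. column S i = {a..b}"
    and bottom: "\<And>i. column S i \<noteq> {} \<Longrightarrow> column S (i + 1) \<noteq> {} \<Longrightarrow>
      Min (column S (i + 1)) = Min (column S i) + 1"
    using assms by (auto simp: fibonacci_polyomino_def polyomino_def column_convex_def)
  obtain lo hi where lo: "\<And>i. column S i = {lo i..hi i}"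
    using convex by metis
  have mem: "(i, j) \<in> S \<longleftrightarrow> lo i \<le> j \<and> j \<le> hi i" for i j
    using lo [of i] by (auto simp: column_def)
  define a where "a = Min (fst ` S)"
  define z where "z = Max (fst ` S)"
  have range: "a \<le> i" "i \<le> z" if "(i, j) \<in> S" for i j
    using that fin by (auto simp: a_def z_def intro!: Min_le Max_ge image_eqI)
  obtain ja where ja: "(a, ja) \<in> S"
    using Min_in [of "fst ` S"] fin ne unfolding a_def [symmetric] by fastforce
  obtain jz where jz: "(z, jz) \<in> S"
    using Max_in [of "fst ` S"] fin ne unfolding z_def [symmetric] by fastforce
  have cross: "\<exists>j. (k, j) \<in> S \<and> (k + 1, j) \<in> S" if "a \<le> k" "k < z" for k
    using reachable_crosses_column [OF conn [OF ja jz], of k] that by auto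
  have nonempty: "lo k \<le> hi k" if "a \<le> k" "k \<le> z" for k
  proof (cases "k = z")
    case True
    then show ?thesis using jz by (auto simp: mem)
  next
    case False
    then show ?thesis using cross [of k] that by (auto simp: mem)
  qed
  have Min_col: "Min (column S k) = lo k" if "lo k \<le> hi k" for k
    unfolding lo using that by (intro Min_eqI) auto
  have step: "lo (k + 1) = lo k + 1" if "a \<le> k" "k < z" for k
    using bottom [of k] nonempty [of k] nonempty [of "k + 1"] that
    by (simp add: Min_col) (simp add: lo)
  \<comment> \<open>A common row \<open>j\<close> satisfies
    \<open>lo k + 1 = lo (k + 1) <= j <= hi k\<close>, so every column but the last has height at
    least 2.\<close>
  have tall: "lo k < hi k" if "a \<le> k" "k < z" for k
    using cross [OF that] step [OF that] by (auto simp: mem)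
  have lo_eq: "lo (a + int k) = lo a + int k" if "a + int k \<le> z" for k
    using that
  proof (induction k)
    case (Suc k)
    then show ?case using step [of "a + int k"] by (simp add: algebra_simps)
  qed simp
  have az: "a \<le> z" using range [OF ja] by simp
  define hs where "hs = map (\<lambda>k. nat (hi (a + int k) - lo (a + int k) + 1)) [0..<nat (z - a + 1)]"
  have nth: "hs ! k = nat (hi (a + int k) - lo (a + int k) + 1)" if "k < length hs" for k
    using that by (simp add: hs_def)
  have len: "int (length hs) = z - a + 1" using az by (simp add: hs_def)
  have "fib_heights hs"
    unfolding fib_heights_iff_nth
  proof (intro conjI allI impI)
    show "hs \<noteq> []" using len az by auto
    show "1 \<le> hs ! k" if "k < length hs" for k
      using nonempty [of "a + int k"] that len by (simp add: nth)
    show "2 \<le> hs ! k" if "Suc k < length hs" for k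
      using tall [of "a + int k"] that len by (simp add: nth)
  qed
  moreover have "S = shift a (lo a) ` fib_cells hs"
  proof (intro set_eqI, clarify)
    fix i j
    show "(i, j) \<in> S \<longleftrightarrow> (i, j) \<in> shift a (lo a) ` fib_cells hs"
    proof (cases "a \<le> i \<and> i \<le> z")
      case True
      define k where "k = nat (i - a)"
      have i: "i = a + int k" and k: "k < length hs" using True len by (auto simp: k_def)
      have "lo i = lo a + int k" using lo_eq True i by simp
      then show ?thesis
        using k nonempty [of i] True by (auto simp: mem i mem_shift_image_iff mem_fib_cells nth)
    next
      case False
      then show ?thesis using range [of i j] len by (auto simp: mem_shift_image_iff mem_fib_cells)
    qed
  qed
  ultimately show ?thesis by (rule that)
qed

section \<open>Translation classes\<close>

lemma mem_translation_rel: "(S, T) \<in> translation_rel \<longleftrightarrow> (\<exists>a b. T = shift a b ` S)"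
  by (simp add: translation_rel_def shift_def)

lemma equiv_translation_rel: "equiv UNIV translation_rel"
proof (rule equivI)
  show "refl translation_rel"
    by (auto simp: refl_on_def mem_translation_rel mem_shift_image_iff intro!: exI [of _ 0])
  show "sym translation_rel"
  proof (rule symI)
    fix S T assume "(S, T) \<in> translation_rel"
    then obtain a b where T: "T = shift a b ` S" by (auto simp: mem_translation_rel)
    have "S = shift (- a) (- b) ` T"
      unfolding T by (auto simp: mem_shift_image_iff)
    then show "(T, S) \<in> translation_rel" by (auto simp: mem_translation_rel)
  qed
  show "trans translation_rel"
    by (rule transI) (auto simp: mem_translation_rel shift_shift_image, blast)
qed auto

text \<open>Height sequences biject with translation classes: distinct sequences give inequivalent
  polyominoes, and each class contains some \<open>fib_cells hs\<close> with the same
  semiperimeters.\<close>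

lemma num_fib_polyominoes_eq: "num_fib_polyominoes m n = card (fib_lists m n)"
proof -
  define A where "A = {S. fibonacci_polyomino S \<and> horizontal_semiperimeter S = of_nat m \<and>
               vertical_semiperimeter S = of_nat n}"
  let ?f = "\<lambda>hs. translation_rel `` {fib_cells hs}"
  have "bij_betw ?f (fib_lists m n) (A // translation_rel)"
    unfolding bij_betw_def
  proof (intro conjI inj_onI equalityI subsetI)
    fix hs hs' assume "hs \<in> fib_lists m n" "hs' \<in> fib_lists m n" "?f hs = ?f hs'"
    moreover from this have "(fib_cells hs, fib_cells hs') \<in> translation_rel"
      using eq_equiv_class [OF _ equiv_translation_rel] by blast
    ultimately show "hs = hs'"
      using fib_cells_shift_eqD by (auto simp: fib_lists_def mem_translation_rel)
  next
    fix X assume "X \<in> ?f ` fib_lists m n"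
    then obtain hs where hs: "hs \<in> fib_lists m n" "X = ?f hs" by blast
    then have "fib_cells hs \<in> A"
      by (simp add: A_def fib_lists_def fibonacci_polyomino_fib_cells
          horizontal_semiperimeter_fib_cells vertical_semiperimeter_fib_cells)
    then show "X \<in> A // translation_rel" unfolding hs(2) by (rule quotientI)
  next
    fix X assume "X \<in> A // translation_rel"
    then obtain S where S: "S \<in> A" "X = translation_rel `` {S}" by (rule quotientE)
    then obtain hs a b where hs: "fib_heights hs" "S = shift a b ` fib_cells hs"
      using fibonacci_polyomino_is_shifted_fib_cells unfolding A_def by blast
    then have "(fib_cells hs, S) \<in> translation_rel" by (auto simp: mem_translation_rel)
    then have "X = ?f hs"
      unfolding S(2) using equiv_class_eq [OF equiv_translation_rel] by metis
    moreover have "hs \<in> fib_lists m n"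
      using S(1) hs
      by (simp add: A_def fib_lists_def finite_fib_cells semiperimeter_shift
          horizontal_semiperimeter_fib_cells vertical_semiperimeter_fib_cells)
    ultimately show "X \<in> ?f ` fib_lists m n" by blast
  qed
  then show ?thesis unfolding num_fib_polyominoes_def A_def by (rule bij_betw_same_card [symmetric])
qed

section \<open>Coefficients of the generating function\<close>

lemma fps_nth_sum_const_X_power:
  "fps_nth (\<Sum>k=0..n. fps_const (c k) * fps_X ^ k) j = (if j \<le> n then c j else (0 :: 'a :: comm_ring_1))"
proof -
  have "fps_nth (\<Sum>k=0..n. fps_const (c k) * fps_X ^ k) j = (\<Sum>k=0..n. if k = j then c k else 0)"
    unfolding fps_sum_nth by (intro sum.cong) (auto simp: fps_X_power_nth)
  then show ?thesis by simp
qed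

lemma fps_nth_one_plus_X_times_X_mult:
  "fps_nth ((1 + fps_X) * fps_X * f) m =
     (case m of 0 \<Rightarrow> 0 | Suc 0 \<Rightarrow> fps_nth f 0 | Suc (Suc k) \<Rightarrow> fps_nth f (Suc k) + fps_nth f k)"
  for f :: "'a :: comm_ring_1 fps"
  by (simp add: distrib_right mult.assoc split: nat.split)

theorem theorem2p8:
  shows "(\<forall>n\<ge>2. fps_nth fib_polyomino_gf n =
            (1 + fps_X) * fps_X *
            (\<Sum>k=0..n-2. fps_const (catalan (k + 1) * of_nat ((n - 2) choose k)) * fps_X ^ k))
         \<and> fps_nth fib_polyomino_gf 1 = fps_X"
proof (intro conjI allI impI fps_ext)
  have gf: "fps_nth (fps_nth fib_polyomino_gf n) m =
      (case m of 0 \<Rightarrow> 0 | Suc l \<Rightarrow> of_nat (card (tall_lists (Suc l) n)) +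
        (if l = 0 then (if n = 1 then 1 else 0) else of_nat (card (tall_lists l n))))"
    if "n \<ge> 1" for n m
    using that
    by (auto simp: fib_polyomino_gf_def num_fib_polyominoes_eq card_fib_lists_Suc split: nat.split)
  {
    fix n m :: nat assume n: "n \<ge> 2"
    define c where "c k = catalan (k + 1) * of_nat ((n - 2) choose k)" for k
    have tall: "of_nat (card (tall_lists (Suc k) n)) = c k" for k
      using card_tall_lists [of "Suc k" n] n by (simp add: c_def)
    \<comment> \<open>Stopping at \<open>n - 2\<close> loses nothing, as the binomial in
      \<open>c j\<close> vanishes for larger \<open>j\<close>.\<close>
    have "fps_nth (\<Sum>k=0..n-2. fps_const (c k) * fps_X ^ k) j = c j" for j
      by (simp add: fps_nth_sum_const_X_power c_def)
    then show "fps_nth (fps_nth fib_polyomino_gf n) m = fps_nth ((1 + fps_X) * fps_X *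
        (\<Sum>k=0..n-2. fps_const (catalan (k + 1) * of_nat ((n - 2) choose k)) * fps_X ^ k)) m"
      unfolding c_def [symmetric] using n
      by (auto simp: gf fps_nth_one_plus_X_times_X_mult tall split: nat.split)
  next
    fix m :: nat
    \<comment> \<open>For \<open>n = 1\<close> there are no tall lists of positive length, so only
      the single cell \<open>[1]\<close> remains.\<close>
    show "fps_nth (fps_nth fib_polyomino_gf 1) m = fps_nth fps_X m"
      using card_tall_lists [of _ 1] by (auto simp: gf split: nat.split)
  }
qed

end
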